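(* Let $\omega_S\in\mathbb R$, let $\vec a,\vec b,\vec c\in\mathbb R^3$ be not all zero, and let $C$ be a $2\times2$ Hermitian matrix with $iC\in\mathfrak{su}(2)$. Let $\mathcal B=\mathbf 1\otimes\mathfrak{su}(2)$ (i.e. $\dim\mathcal B=3$) and let $\mathcal L$ be the real Lie algebra generated by $\mathcal B$ together with the matrix $$\omega_S\,\sigma_z\otimes\mathbf 1+i\sigma_a\otimes\sigma_x+i\sigma_b\otimes\sigma_y+i\sigma_c\otimes\sigma_z+i\,\mathbf 1\otimes C .$$ Let $K$ be the real $3\times 3$ matrix with rows $\vec a^{\,T},\vec b^{\,T},\vec c^{\,T}$, and write $K=(D\;\;F)$ with $D$ of size $3\times2$ (the first two columns) and $F$ of size $3\times1$ (the last column). If $\omega_S\neq0$, then: (1a) if $D\neq0$ and $F\neq0$, then $\mathcal L=\mathfrak{su}(4)$ (the system is completely controllable); (1b) if $D\neq0$ and $F=0$, then $\mathcal L=\mathrm{span}\{\sigma_z\otimes\mathbf 1,\ \mathbf 1\otimes\mathfrak{su}(2),\ i\sigma_x\otimes\mathfrak{su}(2),\ i\sigma_y\otimes\mathfrak{su}(2)\}$, which is $10$-dimensional; (1c) if $D=0$ and $F\neq0$, then $\mathcal L=\mathrm{span}\{i\sigma_z\otimes\mathfrak{su}(2),\ \sigma_z\otimes\mathbf 1,\ \mathbf 1\otimes\mathfrak{su}(2)\}$, which is $7$-dimensional. If $\omega_S=0$, then: (2a) if $\mathrm{rank}(K)=1$, there exists $\sigma\in\mathfrak{su}(2)$ such that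 $\mathcal L=\mathrm{span}\{i\sigma\otimes\mathfrak{su}(2),\ \mathbf 1\otimes\mathfrak{su}(2)\}$; (2b) if $\mathrm{rank}(K)=2$, then $\mathcal L$ is conjugate (and therefore isomorphic) to the Lie algebra $\mathrm{span}\{\sigma_z\otimes\mathbf 1,\ \mathbf 1\otimes\mathfrak{su}(2),\ i\sigma_x\otimes\mathfrak{su}(2),\ i\sigma_y\otimes\mathfrak{su}(2)\}$; (2c) if $\mathrm{rank}(K)=3$, then $\mathcal L=\mathfrak{su}(4)$ (the system is completely controllable).
   Context: $\mathbf 1$ is the $2\times2$ identity. $\mathfrak{su}(n)$ is the real Lie algebra of traceless skew-Hermitian $n\times n$ matrices; spans and generated Lie algebras are over $\mathbb R$. The matrices $$\sigma_x=\frac i2\begin{pmatrix}0&1\\1&0\end{pmatrix},\quad \sigma_y=\frac i2\begin{pmatrix}0&i\\-i&0\end{pmatrix},\quad \sigma_z=\frac i2\begin{pmatrix}1&0\\0&-1\end{pmatrix}$$ form a basis of $\mathfrak{su}(2)$ with $[\sigma_x,\sigma_y]=\sigma_z$, $[\sigma_y,\sigma_z]=\sigma_x$, $[\sigma_z,\sigma_x]=\sigma_y$. For $\vec a=(a_x,a_y,a_z)^T\in\mathbb R^3$, $\sigma_a:=a_x\sigma_x+a_y\sigma_y+a_z\sigma_z$, and similarly $\sigma_b,\sigma_c$ for $\vec b,\vec c$. For a matrix $M$, $M\otimes\mathfrak{su}(2)=\{M\otimes\tau:\tau\in\mathfrak{su}(2)\}$; a span of several such sets and matrices is the real span of their union.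 Two Lie subalgebras $\mathcal L_1,\mathcal L_2$ of $\mathfrak{su}(4)$ are conjugate if $\mathcal L_1=W\mathcal L_2W^\dagger$ for some $4\times4$ unitary $W$. $\mathcal L$ is the dynamical Lie algebra of a system of two interacting qubits $S$ (first factor) and $A$ (second factor), with control acting on $A$ only. *)

theory Defs
  imports "HOL-Analysis.Analysis"
begin

definition cmat_scale :: "complex \<Rightarrow> complex^'n^'m \<Rightarrow> complex^'n^'m"  (infixr \<open>*\<^sub>C\<close> 75)
  where "c *\<^sub>C A = (\<chi> i j. c * A $ i $ j)"

definition ctranspose :: "complex^'n^'m \<Rightarrow> complex^'m^'n"
  where "ctranspose A = (\<chi> i j. cnj (A $ j $ i))"

definition hermitian :: "complex^'n^'n \<Rightarrow> bool"
  where "hermitian A \<longleftrightarrow> ctranspose A = A"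

definition unitary :: "complex^'n^'n \<Rightarrow> bool"
  where "unitary W \<longleftrightarrow> ctranspose W ** W = mat 1 \<and> W ** ctranspose W = mat 1"

definition commutator :: "complex^'n^'n \<Rightarrow> complex^'n^'n \<Rightarrow> complex^'n^'n"
  where "commutator X Y = X ** Y - Y ** X"

(* The size of the matrices is the cardinality of the index type. *)
definition su :: "(complex^'n^'n) set"
  where "su = {X. ctranspose X = - X \<and> trace X = 0}"

(* Rows and columns of a tensor product are indexed by pairs, so two-qubit operators have
   index type 2 \<times> 2, and su(4) is su :: (complex^(2\<times>2)^(2\<times>2)) set. *)
definition kronecker ::
    "complex^'n^'m \<Rightarrow> complex^'q^'p \<Rightarrow> complex^('n \<times> 'q)^('m \<times> 'p)"  (infixr \<open>\<otimes>\<^sub>K\<close> 72)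
  where "A \<otimes>\<^sub>K B = (\<chi> i j. A $ fst i $ fst j * B $ snd i $ snd j)"

definition tensor_su2 :: "complex^2^2 \<Rightarrow> (complex^(2 \<times> 2)^(2 \<times> 2)) set"
  where "tensor_su2 M = {M \<otimes>\<^sub>K \<tau> | \<tau>. \<tau> \<in> su}"

definition sigma_x :: "complex^2^2"
  where "sigma_x = (\<i> / 2) *\<^sub>C vector [vector [0, 1], vector [1, 0]]"

(* This is minus the usual i/2 times the Pauli matrix; with this sign
   [sigma_x, sigma_y] = sigma_z and its cyclic variants hold. *)
definition sigma_y :: "complex^2^2"
  where "sigma_y = (\<i> / 2) *\<^sub>C vector [vector [0, \<i>], vector [- \<i>, 0]]"

definition sigma_z :: "complex^2^2"
  where "sigma_z = (\<i> / 2) *\<^sub>C vector [vector [1, 0], vector [0, - 1]]"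

definition sigma_vec :: "real^3 \<Rightarrow> complex^2^2"
  where "sigma_vec a = a $ 1 *\<^sub>R sigma_x + a $ 2 *\<^sub>R sigma_y + a $ 3 *\<^sub>R sigma_z"

(* On complex matrices, subspace, span and dim refer to the real vector space structure. *)
definition lie_subalgebra :: "(complex^'n^'n) set \<Rightarrow> bool"
  where "lie_subalgebra L \<longleftrightarrow> subspace L \<and> (\<forall>X\<in>L. \<forall>Y\<in>L. commutator X Y \<in> L)"

definition lie_generated :: "(complex^'n^'n) set \<Rightarrow> (complex^'n^'n) set"
  where "lie_generated S = lie_subalgebra hull S"

(* Conjugacy is a relation between Lie subalgebras of su(n). *)
definition lie_conjugate :: "(complex^'n^'n) set \<Rightarrow> (complex^'n^'n) set \<Rightarrow> bool"
  where "lie_conjugate L1 L2 \<longleftrightarrow>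
    lie_subalgebra L1 \<and> L1 \<subseteq> su \<and> lie_subalgebra L2 \<and> L2 \<subseteq> su \<and>
    (\<exists>W. unitary W \<and> L1 = (\<lambda>X. W ** X ** ctranspose W) ` L2)"

definition lie_isomorphic :: "(complex^'n^'n) set \<Rightarrow> (complex^'m^'m) set \<Rightarrow> bool"
  where "lie_isomorphic L1 L2 \<longleftrightarrow>
    lie_subalgebra L1 \<and> lie_subalgebra L2 \<and>
    (\<exists>f. bij_betw f L1 L2 \<and>
      (\<forall>X\<in>L1. \<forall>Y\<in>L1. f (X + Y) = f X + f Y) \<and>
      (\<forall>r. \<forall>X\<in>L1. f (r *\<^sub>R X) = r *\<^sub>R f X) \<and>
      (\<forall>X\<in>L1. \<forall>Y\<in>L1. f (commutator X Y) = commutator (f X) (f Y)))"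

definition drift ::
    "real \<Rightarrow> real^3 \<Rightarrow> real^3 \<Rightarrow> real^3 \<Rightarrow> complex^2^2 \<Rightarrow> complex^(2 \<times> 2)^(2 \<times> 2)"
  where "drift \<omega>\<^sub>S a b c C =
    \<omega>\<^sub>S *\<^sub>R (sigma_z \<otimes>\<^sub>K mat 1)
    + \<i> *\<^sub>C (sigma_vec a \<otimes>\<^sub>K sigma_x) + \<i> *\<^sub>C (sigma_vec b \<otimes>\<^sub>K sigma_y)
    + \<i> *\<^sub>C (sigma_vec c \<otimes>\<^sub>K sigma_z) + \<i> *\<^sub>C (mat 1 \<otimes>\<^sub>K C)"

end

theory Submission
  imports Defs
begin

text \<open>Write \<open>S u = \<sigma>\<^sub>u \<otimes> \<one>\<close>, \<open>B t = \<one> \<otimes> \<sigma>\<^sub>t\<close>, \<open>T v t = i \<sigma>\<^sub>v \<otimes> \<sigma>\<^sub>t\<close>. All brackets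
  of these are given by cross products: \<open>[S u, T v t] = T (u \<times> v) t\<close>,
  \<open>[T u s, T v t] = (s \<bullet> t) / 4 S (u \<times> v) + (u \<bullet> v) / 4 B (s \<times> t)\<close>, and so on. Double brackets of the
  drift with the \<open>B t\<close> separate its summands, so a Lie algebra containing all \<open>B t\<close> and the drift is
  spanned by the \<open>B t\<close>, the \<open>S u\<close> with \<open>u \<in> W\<close> and the \<open>T v t\<close> with \<open>v \<in> V\<close>, where \<open>(W, V)\<close> is the
  least pair of subspaces of \<open>\<real>\<^sup>3\<close> with \<open>\<omega>\<^sub>S e\<^sub>3 \<in> W\<close>, \<open>a, b, c \<in> V\<close>, \<open>W \<times> V \<subseteq> V\<close> and
  \<open>V \<times> V \<subseteq> W\<close>. Each case of the theorem computes this pair. When \<open>\<omega>\<^sub>S = 0\<close> and the rank is 2,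
  it consists of a plane and its normal line, and a half turn takes it to the plane of \<open>e\<^sub>1, e\<^sub>2\<close>
  and the line of \<open>e\<^sub>3\<close>.\<close>

section \<open>Entrywise rules, Kronecker products and real-linear matrix algebra\<close>

lemma cmat_scale_nth [simp]: "(c *\<^sub>C A) $ i $ j = c * A $ i $ j"
  by (simp add: cmat_scale_def)

lemma ctranspose_nth [simp]: "ctranspose A $ i $ j = cnj (A $ j $ i)"
  by (simp add: ctranspose_def)

lemma kronecker_nth [simp]: "(A \<otimes>\<^sub>K B) $ i $ j = A $ fst i $ fst j * B $ snd i $ snd j"
  by (simp add: kronecker_def)

lemma kronecker_mult:
  "(A \<otimes>\<^sub>K B) ** (C \<otimes>\<^sub>K D) = (A ** C) \<otimes>\<^sub>K (B ** D)"
  for A :: "complex^'n^'m" and B :: "complex^'q^'p" and C :: "complex^'k^'n" and D :: "complex^'r^'q"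
proof -
  have "(\<Sum>k\<in>UNIV. A $ a $ fst k * B $ b $ snd k * (C $ fst k $ c * D $ snd k $ d)) =
      (\<Sum>k\<in>UNIV. A $ a $ k * C $ k $ c) * (\<Sum>k\<in>UNIV. B $ b $ k * D $ k $ d)" for a b c d
    by (simp add: sum_product sum.cartesian_product case_prod_unfold mult_ac flip: UNIV_Times_UNIV)
  then show ?thesis
    by (simp add: vec_eq_iff matrix_matrix_mult_def)
qed

lemma kronecker_add_left: "(A + A') \<otimes>\<^sub>K B = A \<otimes>\<^sub>K B + A' \<otimes>\<^sub>K B"
  by (simp add: vec_eq_iff algebra_simps)

lemma kronecker_add_right: "A \<otimes>\<^sub>K (B + B') = A \<otimes>\<^sub>K B + A \<otimes>\<^sub>K B'"
  by (simp add: vec_eq_iff algebra_simps)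

lemma kronecker_diff_left: "(A - A') \<otimes>\<^sub>K B = A \<otimes>\<^sub>K B - A' \<otimes>\<^sub>K B"
  by (simp add: vec_eq_iff algebra_simps)

lemma kronecker_diff_right: "A \<otimes>\<^sub>K (B - B') = A \<otimes>\<^sub>K B - A \<otimes>\<^sub>K B'"
  by (simp add: vec_eq_iff algebra_simps)

lemma kronecker_scaleR_left: "(r *\<^sub>R A) \<otimes>\<^sub>K B = r *\<^sub>R (A \<otimes>\<^sub>K B)"
  by (simp add: vec_eq_iff)

lemma kronecker_scaleR_right: "A \<otimes>\<^sub>K (r *\<^sub>R B) = r *\<^sub>R (A \<otimes>\<^sub>K B)"
  by (simp add: vec_eq_iff)

lemma kronecker_minus_left: "(- A) \<otimes>\<^sub>K B = - (A \<otimes>\<^sub>K B)"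
  by (simp add: vec_eq_iff)

lemmas kronecker_simps = kronecker_add_left kronecker_add_right kronecker_diff_left
  kronecker_diff_right kronecker_scaleR_left kronecker_scaleR_right kronecker_minus_left

lemma ctranspose_kronecker: "ctranspose (A \<otimes>\<^sub>K B) = ctranspose A \<otimes>\<^sub>K ctranspose B"
  by (simp add: vec_eq_iff)

lemma cmat_scale_mult_left: "(c *\<^sub>C A) ** B = c *\<^sub>C (A ** B)"
  by (simp add: vec_eq_iff matrix_matrix_mult_def sum_distrib_left mult_ac)

lemma cmat_scale_mult_right: "A ** (c *\<^sub>C B) = c *\<^sub>C (A ** B)"
  by (simp add: vec_eq_iff matrix_matrix_mult_def sum_distrib_left mult_ac)

lemma cmat_scale_add: "c *\<^sub>C (A + B) = c *\<^sub>C A + c *\<^sub>C B"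
  by (simp add: vec_eq_iff algebra_simps)

lemma cmat_scale_scaleR: "c *\<^sub>C (r *\<^sub>R A) = r *\<^sub>R (c *\<^sub>C A)"
  by (simp add: vec_eq_iff)

lemma matrix_scaleR_left: "(r *\<^sub>R A) ** B = r *\<^sub>R (A ** B)" for A :: "complex^'n^'m"
  by (simp add: vec_eq_iff matrix_matrix_mult_def scaleR_sum_right)

lemma matrix_scaleR_right: "A ** (r *\<^sub>R B) = r *\<^sub>R (A ** B)" for A :: "complex^'n^'m"
  by (simp add: vec_eq_iff matrix_matrix_mult_def scaleR_sum_right)

lemma matrix_mult_minus_left: "(- A) ** B = - (A ** B)" for A :: "complex^'n^'m"
  by (simp add: vec_eq_iff matrix_matrix_mult_def sum_negf)

lemma matrix_mult_minus_right: "A ** (- B) = - (A ** B)" for A :: "complex^'n^'m"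
  by (simp add: vec_eq_iff matrix_matrix_mult_def sum_negf)

lemma matrix_diff_ldistrib: "A ** (B - C) = A ** B - A ** C" for A :: "complex^'n^'m"
  by (simp add: vec_eq_iff matrix_matrix_mult_def sum_subtractf algebra_simps)

lemma matrix_diff_rdistrib: "(B - C) ** A = B ** A - C ** A" for A :: "complex^'n^'m"
  by (simp add: vec_eq_iff matrix_matrix_mult_def sum_subtractf algebra_simps)

lemma matrix_add_rdistrib: "(B + C) ** A = B ** A + C ** A" for A :: "complex^'n^'m"
  by (simp add: vec_eq_iff matrix_matrix_mult_def sum.distrib algebra_simps)

section \<open>Commutators, Lie subalgebras and conjugation by unitaries\<close>

lemma bilinear_commutator: "bilinear (commutator :: complex^'n^'n \<Rightarrow> _)"
  by (auto simp: bilinear_def commutator_def matrix_add_ldistrib matrix_add_rdistrib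
      matrix_scaleR_left matrix_scaleR_right algebra_simps intro!: linearI)

lemma commutator_swap: "commutator Y X = - commutator X Y"
  by (simp add: commutator_def)

text \<open>By bilinearity it is enough to know the brackets of generators. The extension to the
  span is made in the left argument first, with the right one still in \<open>G\<close>, and then in
  the right argument.\<close>

lemma lie_subalgebra_span:
  assumes "\<And>X Y. X \<in> G \<Longrightarrow> Y \<in> G \<Longrightarrow> commutator X Y \<in> span G"
  shows "lie_subalgebra (span G)"
proof -
  have left: "commutator X Y \<in> span G" if "X \<in> span G" and Y: "Y \<in> G" for X Y
    using that(1)
  proof (induction rule: span_induct_alt)
    case base
    then show ?case by (simp add: commutator_def span_zero)
  next
    case (step r x y)
    then show ?case
      using assms[OF _ Y]
      by (simp add: bilinear_ladd[OF bilinear_commutator] bilinear_lmul[OF bilinear_commutator]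
          span_add span_scale)
  qed
  have "commutator X Y \<in> span G" if "Y \<in> span G" and X: "X \<in> span G" for X Y
    using that(1)
  proof (induction rule: span_induct_alt)
    case base
    then show ?case by (simp add: commutator_def span_zero)
  next
    case (step r x y)
    then show ?case
      using left[OF X]
      by (simp add: bilinear_radd[OF bilinear_commutator] bilinear_rmul[OF bilinear_commutator]
          span_add span_scale)
  qed
  then show ?thesis by (simp add: lie_subalgebra_def)
qed

text \<open>An intersection of Lie subalgebras is again one, so the hull belongs to the class over
  which it is taken.\<close>

lemma lie_subalgebra_lie_generated: "lie_subalgebra (lie_generated G)"
  unfolding lie_generated_def
  by (rule hull_in) (auto simp: lie_subalgebra_def intro: subspace_Inter)

text \<open>The isomorphism undoes the conjugation by \<open>W\<close>. It respects products, hence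
  commutators, because the inner factors \<open>W ** ctranspose W\<close> cancel.\<close>

lemma lie_conjugate_imp_isomorphic:
  assumes "lie_conjugate L1 L2"
  shows "lie_isomorphic L1 L2"
proof -
  from assms obtain W where W: "unitary W" "L1 = (\<lambda>X. W ** X ** ctranspose W) ` L2"
    and L: "lie_subalgebra L1" "lie_subalgebra L2"
    by (auto simp: lie_conjugate_def)
  define f where "f = (\<lambda>X. ctranspose W ** X ** W)"
  have un: "ctranspose W ** W = mat 1" "W ** ctranspose W = mat 1"
    using W(1) by (auto simp: unitary_def)
  have un': "ctranspose W ** (W ** X) = X" "W ** (ctranspose W ** X) = X" for X
    by (simp_all add: un matrix_mul_assoc)
  have inv: "f (W ** X ** ctranspose W) = X" for X
    by (simp add: f_def un un' flip: matrix_mul_assoc)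
  have "bij_betw f L1 L2"
    unfolding bij_betw_def W(2) by (auto simp: inv image_image inj_on_def)
  moreover have "f (X + Y) = f X + f Y" for X Y
    by (simp add: f_def matrix_add_ldistrib matrix_add_rdistrib)
  moreover have "f (r *\<^sub>R X) = r *\<^sub>R f X" for r X
    by (simp add: f_def matrix_scaleR_left matrix_scaleR_right)
  moreover have "f (commutator X Y) = commutator (f X) (f Y)" for X Y
    by (simp add: f_def commutator_def un un' matrix_diff_ldistrib matrix_diff_rdistrib
        flip: matrix_mul_assoc)
  ultimately show ?thesis
    using L unfolding lie_isomorphic_def by blast
qed

section \<open>The identification of su(2) with real 3-vectors\<close>

lemma sigma_vec_entries:
  "sigma_vec u $ 1 $ 1 = \<i> / 2 * u $ 3"
  "sigma_vec u $ 1 $ 2 = \<i> / 2 * u $ 1 - u $ 2 / 2"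
  "sigma_vec u $ 2 $ 1 = \<i> / 2 * u $ 1 + u $ 2 / 2"
  "sigma_vec u $ 2 $ 2 = - \<i> / 2 * u $ 3"
  by (simp_all add: sigma_vec_def sigma_x_def sigma_y_def sigma_z_def complex_eq_iff)

text \<open>This is the quaternion product in the present normalisation. All brackets below come
  from it: its antisymmetric part is the cross product and its symmetric part the inner
  product.\<close>

lemma sigma_vec_mult:
  "sigma_vec u ** sigma_vec v = (1/2) *\<^sub>R sigma_vec (cross3 u v) - (inner u v / 4) *\<^sub>R mat 1"
  by (simp add: vec_eq_iff forall_2 matrix_matrix_mult_def sum_2 sigma_vec_entries mat_def
      cross3_def inner_vec_def sum_3 complex_eq_iff field_simps)

lemma linear_sigma_vec: "linear sigma_vec"
  by (rule linearI) (simp_all add: sigma_vec_def algebra_simps)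

lemma ctranspose_sigma_vec: "ctranspose (sigma_vec u) = - sigma_vec u"
  by (simp add: vec_eq_iff forall_2 sigma_vec_entries complex_eq_iff)

lemma trace_sigma_vec: "trace (sigma_vec u) = 0"
  by (simp add: trace_def sum_2 sigma_vec_entries)

lemma su2_eq_range_sigma_vec: "su = range sigma_vec"
proof (intro equalityI subsetI)
  fix X :: "complex^2^2" assume "X \<in> su"
  then have X: "ctranspose X = - X" "trace X = 0" by (auto simp: su_def)
  then have "cnj (X $ j $ i) = - X $ i $ j" for i j
    by (metis ctranspose_nth vector_uminus_component)
  from this[of 1 1] this[of 1 2] this[of 2 1] this[of 2 2] X(2)
  \<comment> \<open>The coordinates are read off the first row of \<open>X\<close>, by solving
    \<open>sigma_vec_entries\<close> for \<open>u\<close>; skewness and zero trace determine the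
    second row.\<close>
  have "X = sigma_vec (vector [2 * Im (X $ 1 $ 2), - 2 * Re (X $ 1 $ 2), 2 * Im (X $ 1 $ 1)])"
    by (simp add: vec_eq_iff forall_2 sigma_vec_entries complex_eq_iff trace_def sum_2)
  then show "X \<in> range sigma_vec" by blast
qed (auto simp: su_def ctranspose_sigma_vec trace_sigma_vec)

lemma tensor_su2_eq_range: "tensor_su2 M = range (\<lambda>t. M \<otimes>\<^sub>K sigma_vec t)"
  by (auto simp: tensor_su2_def su2_eq_range_sigma_vec)

section \<open>Local and product operators on two qubits, and their brackets\<close>

definition sigma_left :: "real^3 \<Rightarrow> complex^(2\<times>2)^(2\<times>2)"
  where "sigma_left u = sigma_vec u \<otimes>\<^sub>K mat 1"

definition sigma_right :: "real^3 \<Rightarrow> complex^(2\<times>2)^(2\<times>2)"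
  where "sigma_right t = mat 1 \<otimes>\<^sub>K sigma_vec t"

text \<open>A tensor product of two skew-Hermitian matrices is Hermitian; the factor
  \<open>\<i>\<close> makes it skew-Hermitian again.\<close>

definition sigma_tensor :: "real^3 \<Rightarrow> real^3 \<Rightarrow> complex^(2\<times>2)^(2\<times>2)"
  where "sigma_tensor u t = \<i> *\<^sub>C (sigma_vec u \<otimes>\<^sub>K sigma_vec t)"

lemma linear_sigma_left: "linear sigma_left"
  by (rule linearI) (simp_all add: sigma_left_def linear_add[OF linear_sigma_vec]
      linear_scale[OF linear_sigma_vec] kronecker_simps)

lemma linear_sigma_right: "linear sigma_right"
  by (rule linearI) (simp_all add: sigma_right_def linear_add[OF linear_sigma_vec]
      linear_scale[OF linear_sigma_vec] kronecker_simps)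

lemma bilinear_sigma_tensor: "bilinear sigma_tensor"
  unfolding bilinear_def
  by (auto intro!: linearI simp: sigma_tensor_def linear_add[OF linear_sigma_vec]
      linear_scale[OF linear_sigma_vec] kronecker_simps cmat_scale_add cmat_scale_scaleR)

text \<open>The reversed product is written with the same \<open>cross3 u v\<close>, so that the two
  halves of a commutator combine or cancel term by term.\<close>

lemma sigma_vec_mult_swap:
  "sigma_vec v ** sigma_vec u = - ((1/2) *\<^sub>R sigma_vec (cross3 u v)) - (inner u v / 4) *\<^sub>R mat 1"
  by (simp add: sigma_vec_mult cross_skew[of v u] linear_neg[OF linear_sigma_vec] inner_commute)

lemma commutator_left_left:
  "commutator (sigma_left u) (sigma_left v) = sigma_left (cross3 u v)"
  unfolding commutator_def sigma_left_def kronecker_mult sigma_vec_mult_swap[of v u] sigma_vec_mult[of u v]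
  by (simp add: kronecker_simps flip: scaleR_left_distrib scaleR_add_left)

lemma commutator_right_right:
  "commutator (sigma_right s) (sigma_right t) = sigma_right (cross3 s t)"
  unfolding commutator_def sigma_right_def kronecker_mult sigma_vec_mult_swap[of t s] sigma_vec_mult[of s t]
  by (simp add: kronecker_simps vec_eq_iff)

lemma commutator_left_right: "commutator (sigma_left u) (sigma_right t) = 0"
  by (simp add: commutator_def sigma_left_def sigma_right_def kronecker_mult)

lemma commutator_left_tensor:
  "commutator (sigma_left u) (sigma_tensor v t) = sigma_tensor (cross3 u v) t"
  unfolding commutator_def sigma_left_def sigma_tensor_def cmat_scale_mult_left cmat_scale_mult_right
    kronecker_mult sigma_vec_mult_swap[of v u] sigma_vec_mult[of u v]
  by (simp add: kronecker_simps vec_eq_iff algebra_simps scaleR_conv_of_real[where 'a=complex])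

lemma commutator_right_tensor:
  "commutator (sigma_right s) (sigma_tensor v t) = sigma_tensor v (cross3 s t)"
  unfolding commutator_def sigma_right_def sigma_tensor_def cmat_scale_mult_left cmat_scale_mult_right
    kronecker_mult sigma_vec_mult_swap[of t s] sigma_vec_mult[of s t]
  by (simp add: kronecker_simps vec_eq_iff algebra_simps scaleR_conv_of_real[where 'a=complex])

lemma commutator_right_left: "commutator (sigma_right t) (sigma_left u) = 0"
  by (subst commutator_swap) (simp add: commutator_left_right)

lemma commutator_tensor_left:
  "commutator (sigma_tensor v t) (sigma_left u) = - sigma_tensor (cross3 u v) t"
  by (subst commutator_swap) (simp add: commutator_left_tensor)

lemma commutator_tensor_right:
  "commutator (sigma_tensor v t) (sigma_right s) = - sigma_tensor v (cross3 s t)"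
  by (subst commutator_swap) (simp add: commutator_right_tensor)

text \<open>Each product splits into a cross part and an inner part in either factor. Swapping the
  operands changes the sign of the cross parts only, so cross times cross and inner times inner
  cancel and the two mixed terms remain.\<close>

lemma commutator_tensor_tensor:
  "commutator (sigma_tensor u s) (sigma_tensor v t) =
    (inner s t / 4) *\<^sub>R sigma_left (cross3 u v) + (inner u v / 4) *\<^sub>R sigma_right (cross3 s t)"
  unfolding commutator_def sigma_left_def sigma_right_def sigma_tensor_def
    cmat_scale_mult_left cmat_scale_mult_right
    kronecker_mult sigma_vec_mult_swap[of t s] sigma_vec_mult[of s t]
    sigma_vec_mult_swap[of v u] sigma_vec_mult[of u v]
  by (simp add: kronecker_simps vec_eq_iff algebra_simps scaleR_conv_of_real[where 'a=complex])

lemma sigma_vec_axis: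
  "sigma_vec (axis 1 1) = sigma_x" "sigma_vec (axis 2 1) = sigma_y" "sigma_vec (axis 3 1) = sigma_z"
  by (simp_all add: sigma_vec_def axis_def)

lemma vec3_eq_sum_axis: "u = u $ 1 *\<^sub>R axis 1 1 + u $ 2 *\<^sub>R axis 2 1 + u $ 3 *\<^sub>R axis 3 1"
  for u :: "real^3"
  by (simp add: vec_eq_iff forall_3 axis_def)

lemma sigma_tensor_eq_sum:
  "sigma_tensor v t = t $ 1 *\<^sub>R sigma_tensor v (axis 1 1) + t $ 2 *\<^sub>R sigma_tensor v (axis 2 1)
    + t $ 3 *\<^sub>R sigma_tensor v (axis 3 1)"
  by (subst vec3_eq_sum_axis[of t])
    (simp only: bilinear_radd[OF bilinear_sigma_tensor] bilinear_rmul[OF bilinear_sigma_tensor])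

lemma tensor_su2_mat_1: "tensor_su2 (mat 1) = range sigma_right"
  by (simp add: tensor_su2_eq_range sigma_right_def)

lemma tensor_su2_sigma_vec: "tensor_su2 (\<i> *\<^sub>C sigma_vec u) = range (sigma_tensor u)"
proof -
  have "(\<i> *\<^sub>C A) \<otimes>\<^sub>K B = \<i> *\<^sub>C (A \<otimes>\<^sub>K B)" for A B :: "complex^2^2"
    by (simp add: vec_eq_iff)
  then show ?thesis
    by (simp add: tensor_su2_eq_range sigma_tensor_def)
qed

section \<open>Spans of local and product operators, and their closure under brackets\<close>

definition generators :: "(real^3) set \<Rightarrow> (real^3) set \<Rightarrow> (complex^(2\<times>2)^(2\<times>2)) set"
  where "generators W V = sigma_left ` W \<union> range sigma_right \<union> (\<Union>v\<in>V. range (sigma_tensor v))"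

lemma sigma_left_in_span_generators:
  assumes "u \<in> span W"
  shows "sigma_left u \<in> span (generators W V)"
proof -
  have "sigma_left u \<in> span (sigma_left ` W)"
    using assms linear_span_image[OF linear_sigma_left] by blast
  then show ?thesis
    by (rule span_mono[THEN subsetD, rotated]) (auto simp: generators_def)
qed

lemma sigma_right_in_span_generators: "sigma_right t \<in> span (generators W V)"
  by (rule span_base) (auto simp: generators_def)

lemma sigma_tensor_in_span_generators:
  assumes "v \<in> span V"
  shows "sigma_tensor v t \<in> span (generators W V)"
proof -
  have "linear (\<lambda>v. sigma_tensor v t)"
    using bilinear_sigma_tensor by (simp add: bilinear_def)
  then have "sigma_tensor v t \<in> span ((\<lambda>v. sigma_tensor v t) ` V)"
    using assms linear_span_image by blast
  then show ?thesis
    by (rule span_mono[THEN subsetD, rotated]) (auto simp: generators_def)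
qed

lemmas in_span_generators =
  sigma_left_in_span_generators sigma_right_in_span_generators sigma_tensor_in_span_generators

lemma span_generators_subset:
  assumes "subspace L" "\<And>u. u \<in> W \<Longrightarrow> sigma_left u \<in> L" "\<And>t. sigma_right t \<in> L"
    "\<And>v t. v \<in> V \<Longrightarrow> sigma_tensor v t \<in> L"
  shows "span (generators W V) \<subseteq> L"
  using assms by (intro span_minimal) (auto simp: generators_def)

text \<open>This allows a plane to be given either as the set of all its points or by two axes
  spanning it.\<close>

lemma span_generators_cong:
  assumes "span W = span W'" "span V = span V'"
  shows "span (generators W V) = span (generators W' V')"
proof -
  have "span (generators W V) \<subseteq> span (generators W' V')"
    if "span W = span W'" "span V = span V'" for W W' V V'
    using that by (intro span_generators_subset in_span_generators) (auto intro: span_base simp: set_eq_iff)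
  then show ?thesis using assms by blast
qed

text \<open>The three conditions cover the brackets that change the first-qubit vector. A bracket
  with \<open>sigma_right\<close> vanishes or acts on the second factor alone, and the
  \<open>sigma_right\<close> part of a bracket of two tensors always lies in the span.\<close>

lemma lie_subalgebra_span_generators:
  assumes WW: "\<And>u v. u \<in> W \<Longrightarrow> v \<in> W \<Longrightarrow> cross3 u v \<in> span W"
    and WV: "\<And>u v. u \<in> W \<Longrightarrow> v \<in> V \<Longrightarrow> cross3 u v \<in> span V"
    and VV: "\<And>u v. u \<in> V \<Longrightarrow> v \<in> V \<Longrightarrow> cross3 u v \<in> span W"
  shows "lie_subalgebra (span (generators W V))"
proof (rule lie_subalgebra_span)
  fix X Y assume XY: "X \<in> generators W V" "Y \<in> generators W V"
  consider u where "u \<in> W" "X = sigma_left u" | s where "X = sigma_right s"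
    | u s where "u \<in> V" "X = sigma_tensor u s"
    using XY(1) by (auto simp: generators_def)
  note X = this
  consider v where "v \<in> W" "Y = sigma_left v" | t where "Y = sigma_right t"
    | v t where "v \<in> V" "Y = sigma_tensor v t"
    using XY(2) by (auto simp: generators_def)
  note Y = this
  note comm = commutator_left_left commutator_right_right commutator_left_right commutator_right_left
    commutator_left_tensor commutator_right_tensor commutator_tensor_tensor
    commutator_tensor_left commutator_tensor_right
  show "commutator X Y \<in> span (generators W V)"
    by (rule X; rule Y; simp add: comm WW WV VV span_base span_zero span_neg span_add span_scale
        in_span_generators)
qed

text \<open>If a Lie algebra contains \<open>\<one> \<otimes> su(2)\<close>, then the set \<open>W\<close> of all \<open>u\<close> with
  \<open>\<sigma>\<^sub>u \<otimes> \<one>\<close> in it and the set \<open>V\<close> of all \<open>v\<close> with \<open>i \<sigma>\<^sub>v \<otimes> su(2)\<close>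
  inside it satisfy this condition.\<close>

definition cross_closed :: "(real^3) set \<Rightarrow> (real^3) set \<Rightarrow> bool"
  where "cross_closed W V \<longleftrightarrow> subspace W \<and> subspace V \<and>
    (\<forall>u\<in>W. \<forall>v\<in>V. cross3 u v \<in> V) \<and> (\<forall>u\<in>V. \<forall>v\<in>V. cross3 u v \<in> W)"

text \<open>Brackets with \<open>sigma_right\<close> keep \<open>v\<close> and permute the three
  axes of the second factor cyclically, so one axis reaches the others, and linearity gives every
  direction.\<close>

lemma sigma_tensor_all:
  assumes L: "lie_subalgebra L" "\<And>t. sigma_right t \<in> L"
    and "sigma_tensor v (axis 1 1) \<in> L \<or> sigma_tensor v (axis 2 1) \<in> L \<or> sigma_tensor v (axis 3 1) \<in> L"
  shows "sigma_tensor v t \<in> L"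
proof -
  have sub: "subspace L" and br: "X \<in> L \<Longrightarrow> Y \<in> L \<Longrightarrow> commutator X Y \<in> L" for X Y
    using L(1) by (auto simp: lie_subalgebra_def)
  have step: "sigma_tensor v (cross3 s t) \<in> L" if "sigma_tensor v t \<in> L" for s t
    using br[OF L(2) that] by (simp add: commutator_right_tensor)
  have cyc: "sigma_tensor v (axis 2 1) \<in> L" if "sigma_tensor v (axis 1 1) \<in> L"
    using step[OF that, of "axis 3 1"] by (simp add: cross_basis)
  have cyc2: "sigma_tensor v (axis 3 1) \<in> L" if "sigma_tensor v (axis 2 1) \<in> L"
    using step[OF that, of "axis 1 1"] by (simp add: cross_basis)
  have cyc3: "sigma_tensor v (axis 1 1) \<in> L" if "sigma_tensor v (axis 3 1) \<in> L"
    using step[OF that, of "axis 2 1"] by (simp add: cross_basis)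
  have "sigma_tensor v (axis 1 1) \<in> L" "sigma_tensor v (axis 2 1) \<in> L" "sigma_tensor v (axis 3 1) \<in> L"
    using assms(3) cyc cyc2 cyc3 by blast+
  then have "t $ 1 *\<^sub>R sigma_tensor v (axis 1 1) + t $ 2 *\<^sub>R sigma_tensor v (axis 2 1)
      + t $ 3 *\<^sub>R sigma_tensor v (axis 3 1) \<in> L"
    by (intro subspace_add subspace_scale sub)
  then show ?thesis by (simp flip: sigma_tensor_eq_sum)
qed

lemma cross_closed_lie_subalgebra:
  assumes L: "lie_subalgebra L" "\<And>t. sigma_right t \<in> L"
  shows "cross_closed {u. sigma_left u \<in> L} {v. \<forall>t. sigma_tensor v t \<in> L}"
  unfolding cross_closed_def
proof (intro conjI ballI; (clarify)?)
  have sub: "subspace L" and br: "X \<in> L \<Longrightarrow> Y \<in> L \<Longrightarrow> commutator X Y \<in> L" for X Y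
    using L(1) by (auto simp: lie_subalgebra_def)
  show "subspace {u. sigma_left u \<in> L}"
    using linear_subspace_vimage[OF linear_sigma_left sub] by (simp add: vimage_def)
  show "subspace {v. \<forall>t. sigma_tensor v t \<in> L}"
    unfolding subspace_def
    using sub by (auto simp: bilinear_lzero[OF bilinear_sigma_tensor] bilinear_ladd[OF bilinear_sigma_tensor]
        bilinear_lmul[OF bilinear_sigma_tensor] subspace_0 subspace_add subspace_scale)
  show "sigma_tensor (cross3 u v) t \<in> L" if "sigma_left u \<in> L" "\<forall>t. sigma_tensor v t \<in> L" for u v t
    using br[of "sigma_left u" "sigma_tensor v t"] that by (simp add: commutator_left_tensor)
  show "sigma_left (cross3 u v) \<in> L"
    if "\<forall>t. sigma_tensor u t \<in> L" "\<forall>t. sigma_tensor v t \<in> L" for u v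
  proof -
    \<comment> \<open>Equal unit vectors in the second factor have inner product 1 and cross product
      0, which isolates the \<open>sigma_left\<close> term.\<close>
    have "commutator (sigma_tensor u (axis 1 1)) (sigma_tensor v (axis 1 1)) \<in> L"
      using that br by blast
    then have "(1/4) *\<^sub>R sigma_left (cross3 u v) \<in> L"
      by (simp add: commutator_tensor_tensor inner_axis_axis linear_0[OF linear_sigma_right])
    from subspace_scale[OF sub this, of 4] show ?thesis by simp
  qed
qed

section \<open>Separating the summands of the drift, and the Lie algebra it generates\<close>

lemma drift_eq:
  "drift w a b c C = sigma_left (w *\<^sub>R axis 3 1) + sigma_tensor a (axis 1 1) + sigma_tensor b (axis 2 1)
    + sigma_tensor c (axis 3 1) + mat 1 \<otimes>\<^sub>K (\<i> *\<^sub>C C)"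
proof -
  have "\<i> *\<^sub>C (mat 1 \<otimes>\<^sub>K C) = mat 1 \<otimes>\<^sub>K (\<i> *\<^sub>C C)"
    by (simp add: vec_eq_iff)
  then show ?thesis
    by (simp add: drift_def sigma_left_def sigma_tensor_def sigma_vec_axis
        linear_scale[OF linear_sigma_vec] kronecker_scaleR_left)
qed

lemma drift_components:
  assumes L: "lie_subalgebra L" "\<And>t. sigma_right t \<in> L"
    and d: "drift w a b c C \<in> L" and C: "\<i> *\<^sub>C C \<in> su"
  shows "sigma_left (w *\<^sub>R axis 3 1) \<in> L"
    "sigma_tensor a t \<in> L" "sigma_tensor b t \<in> L" "sigma_tensor c t \<in> L"
proof -
  have sub: "subspace L" and br: "X \<in> L \<Longrightarrow> Y \<in> L \<Longrightarrow> commutator X Y \<in> L" for X Y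
    using L(1) by (auto simp: lie_subalgebra_def)
  define Ta Tb Tc where T: "Ta = sigma_tensor a (axis 1 1)" "Tb = sigma_tensor b (axis 2 1)"
    "Tc = sigma_tensor c (axis 3 1)"
  obtain s where "mat 1 \<otimes>\<^sub>K (\<i> *\<^sub>C C) = sigma_right s"
    using C by (auto simp: su2_eq_range_sigma_vec sigma_right_def)
  then have X: "sigma_left (w *\<^sub>R axis 3 1) + Ta + Tb + Tc \<in> L" (is "?X \<in> L")
    using subspace_diff[OF sub d L(2)[of s]] by (simp add: drift_eq T)
  \<comment> \<open>For \<open>s\<close> the k-th axis, the double bracket kills the
    \<open>sigma_left\<close> term and the tensor term along that axis, and negates the other two
    tensor terms.\<close>
  have double: "commutator (sigma_right s) (commutator (sigma_right s) ?X) \<in> L" for s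
    by (intro br L(2) X)
  note lin = bilinear_radd[OF bilinear_commutator] bilinear_rsub[OF bilinear_commutator] commutator_right_left commutator_right_tensor cross_basis
    bilinear_rneg[OF bilinear_sigma_tensor] bilinear_rzero[OF bilinear_sigma_tensor]
    bilinear_rzero[OF bilinear_commutator] bilinear_rneg[OF bilinear_commutator]
  have m: "- Tb - Tc \<in> L" "- Tc - Ta \<in> L" "- Ta - Tb \<in> L"
    using double[of "axis 1 1"] double[of "axis 2 1"] double[of "axis 3 1"] by (simp_all add: T lin)
  note comb = subspace_scale[OF sub subspace_diff[OF sub subspace_diff[OF sub]], of _ _ _ "1/2"]
  \<comment> \<open>Three pairwise sums determine the three terms; cyclic permutations of this
    identity extract \<open>Ta\<close>, \<open>Tb\<close> and \<open>Tc\<close> in turn.\<close>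
  have half: "(1/2) *\<^sub>R (- y - z - (- z - x) - (- x - y)) = x" for x y z :: "complex^(2\<times>2)^(2\<times>2)"
    by (simp add: vec_eq_iff field_simps)
  have TL: "Ta \<in> L" "Tb \<in> L" "Tc \<in> L"
    using comb[OF m(1,2,3)] comb[OF m(2,3,1)] comb[OF m(3,1,2)] by (simp_all only: half)
  then show "sigma_tensor a t \<in> L" "sigma_tensor b t \<in> L" "sigma_tensor c t \<in> L"
    using sigma_tensor_all[OF L] unfolding T by blast+
  from subspace_diff[OF sub subspace_diff[OF sub subspace_diff[OF sub X TL(1)] TL(2)] TL(3)]
  show "sigma_left (w *\<^sub>R axis 3 1) \<in> L" by simp
qed

text \<open>The closure conditions make the right-hand side a Lie subalgebra containing the
  generators. For the reverse inclusion, \<open>least\<close> is applied to the cross-closed pair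
  read off the generated algebra itself. Each case of the theorem is an instance with explicit
  \<open>W\<close> and \<open>V\<close>.\<close>

lemma lie_generated_drift:
  assumes C: "\<i> *\<^sub>C C \<in> su"
    and WW: "\<And>u v. u \<in> W \<Longrightarrow> v \<in> W \<Longrightarrow> cross3 u v \<in> span W"
    and WV: "\<And>u v. u \<in> W \<Longrightarrow> v \<in> V \<Longrightarrow> cross3 u v \<in> span V"
    and VV: "\<And>u v. u \<in> V \<Longrightarrow> v \<in> V \<Longrightarrow> cross3 u v \<in> span W"
    and abc: "w *\<^sub>R axis 3 1 \<in> span W" "a \<in> span V" "b \<in> span V" "c \<in> span V"
    and least: "\<And>W' V'. cross_closed W' V' \<Longrightarrow> w *\<^sub>R axis 3 1 \<in> W' \<Longrightarrow> {a, b, c} \<subseteq> V' \<Longrightarrow>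
      W \<subseteq> W' \<and> V \<subseteq> V'"
  shows "lie_generated (tensor_su2 (mat 1) \<union> {drift w a b c C}) = span (generators W V)"
    (is "?L = ?M")
proof
  have "drift w a b c C \<in> ?M"
  proof -
    have "mat 1 \<otimes>\<^sub>K (\<i> *\<^sub>C C) \<in> range sigma_right"
      using C by (auto simp: su2_eq_range_sigma_vec sigma_right_def)
    then show ?thesis
      unfolding drift_eq by (auto intro!: span_add in_span_generators abc)
  qed
  then show "?L \<subseteq> ?M"
    unfolding lie_generated_def tensor_su2_mat_1
    using lie_subalgebra_span_generators[OF WW WV VV]
    by (intro hull_minimal) (auto intro: in_span_generators)
  have L: "lie_subalgebra ?L" by (rule lie_subalgebra_lie_generated)
  have gen: "tensor_su2 (mat 1) \<union> {drift w a b c C} \<subseteq> ?L"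
    unfolding lie_generated_def by (rule hull_subset)
  then have R: "sigma_right t \<in> ?L" for t
    by (auto simp: tensor_su2_mat_1)
  have "drift w a b c C \<in> ?L" using gen by blast
  note comps = drift_components[OF L R this C]
  have "W \<subseteq> {u. sigma_left u \<in> ?L} \<and> V \<subseteq> {v. \<forall>t. sigma_tensor v t \<in> ?L}"
    by (intro least cross_closed_lie_subalgebra L R) (use comps in blast)+
  then show "?M \<subseteq> ?L"
    using L by (intro span_generators_subset R) (auto simp: lie_subalgebra_def)
qed

section \<open>Cross-closed pairs and coordinate subspaces of real 3-space\<close>

lemma cross_closed_plane:
  assumes "cross_closed W V" "axis 3 1 \<in> W" "v \<in> V" "v $ 1 \<noteq> 0 \<or> v $ 2 \<noteq> 0"
  shows "axis 1 1 \<in> V" "axis 2 1 \<in> V"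
proof -
  have sub: "subspace V" and cr: "\<And>u. u \<in> V \<Longrightarrow> cross3 (axis 3 1) u \<in> V"
    using assms(1,2) by (auto simp: cross_closed_def)
  \<comment> \<open>The vector \<open>q\<close> is the projection of \<open>v\<close> to the plane
    of the first two axes and \<open>p\<close> is its quarter turn; together they form an orthogonal
    basis of that plane, of squared length \<open>r\<close>.\<close>
  define p where "p = cross3 (axis 3 1) v"
  define q where "q = - cross3 (axis 3 1) p"
  define r where "r = (v $ 1)\<^sup>2 + (v $ 2)\<^sup>2"
  have r: "r \<noteq> 0"
    using assms(4) by (simp add: r_def sum_power2_eq_zero_iff)
  have pq: "p \<in> V" "q \<in> V"
    unfolding q_def p_def using assms(3) cr subspace_neg[OF sub] by blast+
  have "(1/r) *\<^sub>R (v $ 1 *\<^sub>R q - v $ 2 *\<^sub>R p) = axis 1 1" "(1/r) *\<^sub>R (v $ 2 *\<^sub>R q + v $ 1 *\<^sub>R p) = axis 2 1"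
    using r by (simp_all add: vec_eq_iff forall_3 q_def p_def axis_def cross_components r_def power2_eq_square)
  then show "axis 1 1 \<in> V" "axis 2 1 \<in> V"
    using pq by (metis sub subspace_add subspace_diff subspace_scale)+
qed

lemma subspace_eq_UNIV:
  assumes "subspace V" "axis 1 1 \<in> V" "axis 2 1 \<in> V" "axis 3 1 \<in> V"
  shows "V = (UNIV :: (real^3) set)"
  using assms vec3_eq_sum_axis by (metis UNIV_eq_I subspace_add subspace_scale)

lemma cross_closed_UNIV:
  assumes "cross_closed W UNIV"
  shows "W = UNIV"
proof (rule subspace_eq_UNIV)
  have cr: "cross3 u v \<in> W" for u v
    using assms by (simp add: cross_closed_def)
  show "axis 1 1 \<in> W" "axis 2 1 \<in> W" "axis 3 1 \<in> W"
    using cr[of "axis 2 1" "axis 3 1"] cr[of "axis 3 1" "axis 1 1"] cr[of "axis 1 1" "axis 2 1"]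
    by (simp_all add: cross_basis)
qed (use assms in \<open>simp add: cross_closed_def\<close>)

lemma span_axis12: "span {axis 1 1, axis 2 1} = {v :: real^3. v $ 3 = 0}"
proof
  show "{v :: real^3. v $ 3 = 0} \<subseteq> span {axis 1 1, axis 2 1}"
  proof clarify
    fix v :: "real^3" assume "v $ 3 = 0"
    then have "v = v $ 1 *\<^sub>R axis 1 1 + v $ 2 *\<^sub>R axis 2 1"
      using vec3_eq_sum_axis[of v] by simp
    then show "v \<in> span {axis 1 1, axis 2 1}"
      by (metis insertI1 insertI2 span_add span_base span_scale)
  qed
qed (rule span_minimal; auto simp: axis_def subspace_def)

lemma span_axis3: "span {axis 3 1} = {v :: real^3. v $ 1 = 0 \<and> v $ 2 = 0}"
proof
  show "{v :: real^3. v $ 1 = 0 \<and> v $ 2 = 0} \<subseteq> span {axis 3 1}"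
  proof clarify
    fix v :: "real^3" assume "v $ 1 = 0" "v $ 2 = 0"
    then have "v = v $ 3 *\<^sub>R axis 3 1"
      using vec3_eq_sum_axis[of v] by simp
    then show "v \<in> span {axis 3 1}"
      by (metis insertI1 span_base span_scale)
  qed
qed (rule span_minimal; auto simp: axis_def subspace_def)

lemma dim_span_axis12: "dim (span {axis 1 1, axis 2 1 :: real^3}) = 2"
proof -
  have "pairwise orthogonal {axis 1 1, axis 2 1 :: real^3}"
    by (auto simp: pairwise_def orthogonal_def inner_axis_axis)
  then have "independent {axis 1 1, axis 2 1 :: real^3}"
    by (rule pairwise_orthogonal_independent) (auto simp: axis_eq_0_iff)
  then show ?thesis
    by (simp add: dim_eq_card_independent axis_eq_axis)
qed

lemma dim_span_axis3: "dim (span {axis 3 1 :: real^3}) = 1"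
  by (simp add: axis_eq_0_iff)

section \<open>Coordinates on su(4) and dimensions\<close>

lemma subspace_su: "subspace su"
  by (auto simp: subspace_def su_def trace_def vec_eq_iff sum.distrib simp flip: scaleR_sum_right)

lemma sum_2x2: "(\<Sum>i\<in>UNIV. f i) = f (1, 1) + f (1, 2) + f (2, 1) + f (2 :: 2, 2 :: 2)"
  by (simp add: sum.cartesian_product' sum_2 add.assoc flip: UNIV_Times_UNIV)

lemma span_generators_subset_su: "span (generators W V) \<subseteq> su"
proof (rule span_generators_subset[OF subspace_su])
  have tr: "trace (A \<otimes>\<^sub>K B) = trace A * trace B" for A B :: "complex^2^2"
    by (simp add: trace_def sum_2 sum_2x2 algebra_simps)
  have id: "ctranspose (mat 1) = (mat 1 :: complex^2^2)"
    by (auto simp: vec_eq_iff mat_def)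
  show "sigma_left u \<in> su" for u
    by (simp add: su_def sigma_left_def ctranspose_kronecker ctranspose_sigma_vec id tr trace_sigma_vec
        kronecker_minus_left)
  show "sigma_right t \<in> su" for t
    \<comment> \<open>The scalar \<open>-1\<close> serves to pull a sign out of the second
      factor.\<close>
    using kronecker_scaleR_right[of "mat 1" "-1" "sigma_vec t"]
    by (simp add: su_def sigma_right_def ctranspose_kronecker ctranspose_sigma_vec id tr trace_sigma_vec)
  show "sigma_tensor u t \<in> su" for u t
  proof -
    have "ctranspose (\<i> *\<^sub>C (sigma_vec u \<otimes>\<^sub>K sigma_vec t)) =
      - (\<i> *\<^sub>C (ctranspose (sigma_vec u) \<otimes>\<^sub>K ctranspose (sigma_vec t)))"
      by (simp add: vec_eq_iff)
    moreover have "trace (\<i> *\<^sub>C A) = \<i> * trace A" for A :: "complex^(2\<times>2)^(2\<times>2)"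
      by (simp add: trace_def sum_distrib_left)
    ultimately show ?thesis
      by (simp add: su_def sigma_tensor_def tr trace_sigma_vec ctranspose_sigma_vec vec_eq_iff)
  qed
qed

text \<open>Five real 3-vectors give the 15 coordinates of su(4). The nine tensor coefficients are
  grouped by the axis of the second factor, so that each group can range over a subspace of
  first-qubit vectors on its own.\<close>

definition sigma_sum :: "(real^3) \<times> (real^3) \<times> (real^3) \<times> (real^3) \<times> (real^3) \<Rightarrow> complex^(2\<times>2)^(2\<times>2)"
  where "sigma_sum = (\<lambda>(u, t, p, q, r). sigma_left u + sigma_right t + sigma_tensor p (axis 1 1)
    + sigma_tensor q (axis 2 1) + sigma_tensor r (axis 3 1))"

lemma linear_sigma_sum: "linear sigma_sum"
  by (rule linearI) (auto simp: sigma_sum_def linear_add[OF linear_sigma_left]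
      linear_add[OF linear_sigma_right] bilinear_ladd[OF bilinear_sigma_tensor]
      linear_scale[OF linear_sigma_left] linear_scale[OF linear_sigma_right]
      bilinear_lmul[OF bilinear_sigma_tensor] algebra_simps)

lemma sigma_sum_entries:
  "sigma_sum (u, t, p, q, r) $ (i, j) $ (k, l) =
     sigma_vec u $ i $ k * (if j = l then 1 else 0) + (if i = k then 1 else 0) * sigma_vec t $ j $ l
     + \<i> * (sigma_vec p $ i $ k * sigma_x $ j $ l + sigma_vec q $ i $ k * sigma_y $ j $ l
         + sigma_vec r $ i $ k * sigma_z $ j $ l)"
  by (simp add: sigma_sum_def sigma_left_def sigma_right_def sigma_tensor_def mat_def sigma_vec_axis
      algebra_simps)

lemma su4_subset_range_sigma_sum: "su \<subseteq> range sigma_sum"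
proof
  fix X :: "complex^(2\<times>2)^(2\<times>2)" assume "X \<in> su"
  then have X: "ctranspose X = - X" "trace X = 0" by (auto simp: su_def)
  have skew: "X $ j $ i = - cnj (X $ i $ j)" for i j
    using arg_cong[OF X(1), of "\<lambda>A. A $ j $ i"] by simp
  define x where "x = (\<lambda>i j k l. X $ (i, j) $ (k, l))"
  have sk: "x k l i j = - cnj (x i j k l)" for i j k l
    by (simp add: x_def skew[of "(k,l)" "(i,j)"])
  have tr: "x 1 1 1 1 + x 1 2 1 2 + x 2 1 2 1 + x 2 2 2 2 = 0"
    using X(2) by (simp add: x_def trace_def sum_2x2)
  \<comment> \<open>The five vectors solve the equations of \<open>sigma_sum_entries\<close>: sums
    and differences of pairs of entries separate the unknowns.\<close>
  define u :: "real^3" where "u = vector [Im (x 1 1 2 1) + Im (x 1 2 2 2),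
    - Re (x 1 1 2 1) - Re (x 1 2 2 2), Im (x 1 1 1 1) + Im (x 1 2 1 2)]"
  define t :: "real^3" where "t = vector [Im (x 1 1 1 2) + Im (x 2 1 2 2),
    - Re (x 1 1 1 2) - Re (x 2 1 2 2), Im (x 1 1 1 1) + Im (x 2 1 2 1)]"
  define p :: "real^3" where "p = vector [- 2 * (Im (x 1 1 2 2) + Im (x 1 2 2 1)),
    2 * (Re (x 1 1 2 2) + Re (x 1 2 2 1)), 2 * (Im (x 2 1 2 2) - Im (x 1 1 1 2))]"
  define q :: "real^3" where "q = vector [2 * (Re (x 1 1 2 2) - Re (x 1 2 2 1)),
    2 * (Im (x 1 1 2 2) - Im (x 1 2 2 1)), 2 * (Re (x 1 1 1 2) - Re (x 2 1 2 2))]"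
  define r :: "real^3" where "r = vector [2 * (Im (x 1 2 2 2) - Im (x 1 1 2 1)),
    - 2 * (Re (x 1 2 2 2) - Re (x 1 1 2 1)), 2 * (Im (x 1 2 1 2) + Im (x 2 1 2 1))]"
  have skRe: "Re (x k l i j) = - Re (x i j k l)" and skIm: "Im (x k l i j) = Im (x i j k l)" for i j k l
    by (simp_all add: sk[of k l i j])
  have re0: "Re (x i j i j) = 0" for i j
    using skRe[of i j i j] by linarith
  \<comment> \<open>Zero trace eliminates the last diagonal entry, and skewness relates mirror
    entries across the diagonal, which leaves 15 free real parameters.\<close>
  have tr': "Im (x 2 2 2 2) = - Im (x 1 1 1 1) - Im (x 1 2 1 2) - Im (x 2 1 2 1)"
    using arg_cong[OF tr, of Im] by simp
  note sw = skRe[of 2 1 1 1] skIm[of 2 1 1 1] skRe[of 1 2 1 1] skIm[of 1 2 1 1]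
    skRe[of 2 2 1 1] skIm[of 2 2 1 1] skRe[of 2 1 1 2] skIm[of 2 1 1 2]
    skRe[of 2 2 1 2] skIm[of 2 2 1 2] skRe[of 2 2 2 1] skIm[of 2 2 2 1]
  have "x i j k l = sigma_sum (u, t, p, q, r) $ (i, j) $ (k, l)" for i j k l
    using exhaust_2[of i] exhaust_2[of j] exhaust_2[of k] exhaust_2[of l]
    by (elim disjE; simp only: sigma_sum_entries)
      (simp_all add: sigma_vec_entries sigma_x_def sigma_y_def sigma_z_def complex_eq_iff
        u_def t_def p_def q_def r_def re0 tr' sw field_simps)
  then have "X = sigma_sum (u, t, p, q, r)"
    by (simp add: x_def vec_eq_iff)
  then show "X \<in> range sigma_sum" by blast
qed

text \<open>Writing the span as a linear image of a product of subspaces yields both the equality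
  with su(4) and, by injectivity, the dimension.\<close>

lemma span_generators_eq_image:
  "span (generators W V) = sigma_sum ` (span W \<times> UNIV \<times> span V \<times> span V \<times> span V)"
    (is "_ = sigma_sum ` ?S")
proof
  have sub: "subspace (sigma_sum ` ?S)"
    by (intro linear_subspace_image linear_sigma_sum subspace_Times subspace_span subspace_UNIV)
  note zero = linear_0[OF linear_sigma_left] linear_0[OF linear_sigma_right]
    bilinear_lzero[OF bilinear_sigma_tensor]
  show "span (generators W V) \<subseteq> sigma_sum ` ?S"
  proof (rule span_generators_subset[OF sub])
    show "sigma_left u \<in> sigma_sum ` ?S" if "u \<in> W" for u
      using that by (intro image_eqI[of _ _ "(u, 0, 0, 0, 0)"]) (auto simp: sigma_sum_def zero span_base span_zero)
    show "sigma_right t \<in> sigma_sum ` ?S" for t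
      by (intro image_eqI[of _ _ "(0, t, 0, 0, 0)"]) (auto simp: sigma_sum_def zero span_zero)
    show "sigma_tensor v t \<in> sigma_sum ` ?S" if "v \<in> V" for v t
      using that
      by (intro image_eqI[of _ _ "(0, 0, t $ 1 *\<^sub>R v, t $ 2 *\<^sub>R v, t $ 3 *\<^sub>R v)"])
        (auto simp: sigma_sum_def zero bilinear_lmul[OF bilinear_sigma_tensor] span_base span_zero span_scale
          simp flip: sigma_tensor_eq_sum)
  qed
  show "sigma_sum ` ?S \<subseteq> span (generators W V)"
    by (auto simp: sigma_sum_def intro!: span_add in_span_generators)
qed

lemma span_generators_UNIV: "span (generators UNIV UNIV) = su"
  using su4_subset_range_sigma_sum span_generators_subset_su[of UNIV UNIV]
  by (intro equalityI) (simp_all add: span_generators_eq_image)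

text \<open>The entries fall into four groups with disjoint sets of coordinates, according to which
  of the two qubit indices differ between row and column. Each group is a small system with only the
  zero solution.\<close>

lemma inj_sigma_sum: "inj sigma_sum"
  unfolding linear_injective_0[OF linear_sigma_sum]
proof clarify
  fix u t p q r assume "sigma_sum (u, t, p, q, r) = 0"
  then have e: "sigma_sum (u, t, p, q, r) $ (i, j) $ (k, l) = 0" for i j k l
    by simp
  note s = sigma_sum_entries sigma_vec_entries sigma_x_def sigma_y_def sigma_z_def complex_eq_iff
  have 1: "u $ 3 = 0 \<and> t $ 3 = 0 \<and> r $ 3 = 0"
    using e[of 1 1 1 1] e[of 1 2 1 2] e[of 2 1 2 1] by (simp add: s)
  have 2: "t $ 1 = 0 \<and> t $ 2 = 0 \<and> p $ 3 = 0 \<and> q $ 3 = 0"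
    using e[of 1 1 1 2] e[of 2 1 2 2] by (simp add: s)
  have 3: "u $ 1 = 0 \<and> u $ 2 = 0 \<and> r $ 1 = 0 \<and> r $ 2 = 0"
    using e[of 1 1 2 1] e[of 1 2 2 2] by (simp add: s)
  have 4: "p $ 1 = 0 \<and> p $ 2 = 0 \<and> q $ 1 = 0 \<and> q $ 2 = 0"
    using e[of 1 1 2 2] e[of 1 2 2 1] by (simp add: s)
  show "(u, t, p, q, r) = 0"
    using 1 2 3 4 by (simp add: zero_prod_def vec_eq_iff forall_3)
qed

lemma dim_span_generators: "dim (span (generators W V)) = dim (span W) + 3 + 3 * dim (span V)"
proof -
  have "dim (span (generators W V)) = dim (span W \<times> (UNIV :: (real^3) set) \<times> span V \<times> span V \<times> span V)"
    unfolding span_generators_eq_image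
    by (intro dim_image_eq linear_sigma_sum inj_on_subset[OF inj_sigma_sum]) auto
  also have "\<dots> = dim (span W) + 3 + 3 * dim (span V)"
    by (subst dim_Times; (intro subspace_Times subspace_span subspace_UNIV)?)+ simp
  finally show ?thesis .
qed

section \<open>Normals, half turns and the conjugations they induce\<close>

lemma cross_orthogonal_eq_scale:
  assumes "n \<bullet> u = 0" "n \<bullet> v = 0" "norm n = 1"
  shows "cross3 u v = (n \<bullet> cross3 u v) *\<^sub>R n"
proof -
  \<comment> \<open>Two uses of the Lagrange identity: one makes the product with \<open>n\<close>
    vanish, and the double product with the unit vector \<open>n\<close> then compares
    \<open>cross3 u v\<close> with its component along \<open>n\<close>.\<close>
  have "cross3 n (cross3 u v) = 0"
    using assms by (simp add: Lagrange)
  then have "cross3 n (cross3 n (cross3 u v)) = 0" by simp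
  then show ?thesis
    using assms(3) by (simp add: Lagrange[of n n] norm_eq_1)
qed

text \<open>The half turn about the unit vector \<open>m\<close>, implemented on the first qubit by the unitary \<open>2 \<sigma>\<^sub>m\<close>.\<close>

definition half_turn :: "real^3 \<Rightarrow> real^3 \<Rightarrow> real^3"
  where "half_turn m v = (2 * (m \<bullet> v)) *\<^sub>R m - v"

definition half_turn_matrix :: "real^3 \<Rightarrow> complex^(2\<times>2)^(2\<times>2)"
  where "half_turn_matrix m = 2 *\<^sub>R (sigma_vec m \<otimes>\<^sub>K mat 1)"

lemma half_turn_half_turn:
  assumes "norm m = 1"
  shows "half_turn m (half_turn m v) = v"
  using assms by (simp add: half_turn_def norm_eq_1 inner_diff_right algebra_simps)

lemma inner_half_turn: "half_turn m u \<bullet> v = u \<bullet> half_turn m v"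
  by (simp add: half_turn_def inner_diff_left inner_diff_right inner_commute)

text \<open>Since \<open>2 *\<^sub>R sigma_vec m\<close> has adjoint
  \<open>- 2 *\<^sub>R sigma_vec m\<close>, the factor \<open>- (1/4)\<close> is exactly what
  conjugation by it absorbs.\<close>

lemma sigma_vec_half_turn:
  assumes "norm m = 1"
  shows "sigma_vec m ** sigma_vec u ** sigma_vec m = - (1/4) *\<^sub>R sigma_vec (half_turn m u)"
proof -
  have "cross3 (cross3 m u) m = u - (m \<bullet> u) *\<^sub>R m"
    using assms by (simp add: cross_skew[of "cross3 m u"] Lagrange norm_eq_1)
  then have "sigma_vec m ** sigma_vec u ** sigma_vec m =
      (1/4) *\<^sub>R sigma_vec (u - (m \<bullet> u) *\<^sub>R m) - ((m \<bullet> u) / 4) *\<^sub>R sigma_vec m"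
    by (simp add: sigma_vec_mult matrix_diff_rdistrib matrix_scaleR_left dot_cross_self)
  then show ?thesis
    by (simp add: half_turn_def linear_diff[OF linear_sigma_vec] linear_scale[OF linear_sigma_vec]
        vec_eq_iff scaleR_conv_of_real[where 'a=complex] field_simps)
qed

lemma sigma_vec_square:
  assumes "norm m = 1"
  shows "sigma_vec m ** sigma_vec m = - (1/4) *\<^sub>R mat 1"
  using assms by (simp add: sigma_vec_mult norm_eq_1 linear_0[OF linear_sigma_vec])

lemma kronecker_mat_1: "mat 1 \<otimes>\<^sub>K mat 1 = mat 1"
  by (auto simp: vec_eq_iff mat_def)

lemma ctranspose_half_turn_matrix: "ctranspose (half_turn_matrix m) = - half_turn_matrix m"
proof -
  have "cnj (mat 1 $ i $ j) = mat 1 $ j $ i" for i j :: 2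
    by (simp add: mat_def)
  moreover have "cnj (sigma_vec m $ i $ j) = - sigma_vec m $ j $ i" for i j
    using arg_cong[OF ctranspose_sigma_vec[of m], of "\<lambda>A. A $ j $ i"] by simp
  ultimately show ?thesis
    by (simp add: half_turn_matrix_def vec_eq_iff)
qed

lemma unitary_half_turn_matrix:
  assumes "norm m = 1"
  shows "unitary (half_turn_matrix m)"
  unfolding unitary_def ctranspose_half_turn_matrix
  using assms by (simp add: matrix_mult_minus_left
      matrix_mult_minus_right half_turn_matrix_def matrix_scaleR_left matrix_scaleR_right kronecker_mult
      sigma_vec_square kronecker_minus_left kronecker_scaleR_left kronecker_mat_1)

lemma conjugate_half_turn_matrix:
  fixes m :: "real^3"
  defines "f \<equiv> (\<lambda>X. half_turn_matrix m ** X ** ctranspose (half_turn_matrix m))"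
  assumes "norm m = 1"
  shows "f (sigma_left u) = sigma_left (half_turn m u)"
    "f (sigma_right t) = sigma_right t"
    "f (sigma_tensor u t) = sigma_tensor (half_turn m u) t"
  unfolding f_def ctranspose_half_turn_matrix using assms(2)
  by (simp_all add: sigma_left_def sigma_right_def sigma_tensor_def
      matrix_mult_minus_right half_turn_matrix_def matrix_scaleR_left matrix_scaleR_right
      cmat_scale_mult_left cmat_scale_mult_right cmat_scale_scaleR kronecker_mult sigma_vec_half_turn
      sigma_vec_square kronecker_minus_left kronecker_scaleR_left vec_eq_iff)

lemma conjugate_span_generators:
  assumes "norm m = 1"
  shows "(\<lambda>X. half_turn_matrix m ** X ** ctranspose (half_turn_matrix m)) ` span (generators W V) =
    span (generators (half_turn m ` W) (half_turn m ` V))"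
proof -
  have lin: "linear (\<lambda>X. half_turn_matrix m ** X ** ctranspose (half_turn_matrix m))"
    by (rule linearI) (simp_all add: matrix_add_ldistrib matrix_add_rdistrib
      matrix_scaleR_left matrix_scaleR_right)
  show ?thesis
    unfolding linear_span_image[OF lin, symmetric]
    by (simp add: generators_def image_Un image_UN image_image conjugate_half_turn_matrix[OF assms])
qed

text \<open>The axis is the bisector of \<open>n\<close> and \<open>e\<close>. A nonnegative inner
  product excludes opposite vectors, so \<open>n + e\<close> can be normalised.\<close>

lemma exists_half_turn:
  fixes n e :: "real^3"
  assumes "norm n = 1" "norm e = 1" "n \<bullet> e \<ge> 0"
  obtains m where "norm m = 1" "half_turn m e = n"
proof -
  define s where "s = n + e"
  have s: "s \<bullet> s = 2 * (s \<bullet> e)" "s \<bullet> e > 0"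
    using assms by (simp_all add: s_def norm_eq_1 inner_add_left inner_add_right inner_commute)
  then have "s \<noteq> 0" by auto
  then have "norm ((1 / norm s) *\<^sub>R s) = 1" by simp
  moreover have "half_turn ((1 / norm s) *\<^sub>R s) e = (2 * (s \<bullet> e) / (s \<bullet> s)) *\<^sub>R s - e"
    by (simp add: half_turn_def dot_square_norm power2_eq_square)
  then have "half_turn ((1 / norm s) *\<^sub>R s) e = n"
    using s by (simp add: s_def)
  ultimately show ?thesis using that by blast
qed

section \<open>The generated Lie algebra for each configuration of the coupling vectors\<close>

lemma cross_closed_axis3:
  assumes "cross_closed W V" "w *\<^sub>R axis 3 1 \<in> W" "w \<noteq> 0"
  shows "axis 3 1 \<in> W"
  using subspace_scale[of W "w *\<^sub>R axis 3 1" "1/w"] assms by (simp add: cross_closed_def)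

lemma cross_closed_span:
  assumes "cross_closed W V" "S \<subseteq> V"
  shows "span S \<subseteq> V"
  using assms span_minimal unfolding cross_closed_def by blast

lemma axis_nth: "axis i x $ j = (if i = j then x else 0)"
  by (simp add: axis_def)

text \<open>Only \<open>V\<close> has to be shown to be everything, since cross products of its
  elements then fill \<open>W\<close>.\<close>

lemma lie_generated_drift_su4:
  assumes C: "\<i> *\<^sub>C C \<in> su"
    and least: "\<And>W V. cross_closed W V \<Longrightarrow> w *\<^sub>R axis 3 1 \<in> W \<Longrightarrow> {a, b, c} \<subseteq> V \<Longrightarrow> V = UNIV"
  shows "lie_generated (tensor_su2 (mat 1) \<union> {drift w a b c C}) = su"
proof -
  have "lie_generated (tensor_su2 (mat 1) \<union> {drift w a b c C}) = span (generators UNIV UNIV)"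
  proof (rule lie_generated_drift[OF C])
    show "UNIV \<subseteq> W \<and> UNIV \<subseteq> V"
      if "cross_closed W V" "w *\<^sub>R axis 3 1 \<in> W" "{a, b, c} \<subseteq> V" for W V
      using least[OF that] cross_closed_UNIV that(1) by auto
  qed auto
  then show ?thesis by (simp add: span_generators_UNIV)
qed

text \<open>Rotation about the third axis produces the first two axes from \<open>v\<close>;
  subtracting their multiples from \<open>v'\<close> leaves the third. The vectors \<open>v\<close>
  and \<open>v'\<close> may coincide.\<close>

lemma lie_generated_drift_full:
  assumes C: "\<i> *\<^sub>C C \<in> su" and w: "w \<noteq> 0"
    and v: "v \<in> {a, b, c}" "v $ 1 \<noteq> 0 \<or> v $ 2 \<noteq> 0"
    and v': "v' \<in> {a, b, c}" "v' $ 3 \<noteq> 0"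
  shows "lie_generated (tensor_su2 (mat 1) \<union> {drift w a b c C}) = su"
proof (rule lie_generated_drift_su4[OF C])
  fix W V assume cl: "cross_closed W V" and W: "w *\<^sub>R axis 3 1 \<in> W" and abc: "{a, b, c} \<subseteq> V"
  have sub: "subspace V" using cl by (simp add: cross_closed_def)
  have vV: "v \<in> V" "v' \<in> V" using abc v v' by blast+
  have e12: "axis 1 1 \<in> V" "axis 2 1 \<in> V"
    using cross_closed_plane[OF cl cross_closed_axis3[OF cl W w] vV(1) v(2)] by auto
  have "(1 / v' $ 3) *\<^sub>R (v' - v' $ 1 *\<^sub>R axis 1 1 - v' $ 2 *\<^sub>R axis 2 1) \<in> V"
    by (intro subspace_diff subspace_scale sub vV e12)
  also have "(1 / v' $ 3) *\<^sub>R (v' - v' $ 1 *\<^sub>R axis 1 1 - v' $ 2 *\<^sub>R axis 2 1) = axis 3 1"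
    using v'(2) by (simp add: vec_eq_iff forall_3 axis_nth)
  finally show "V = UNIV" using subspace_eq_UNIV sub e12 by blast
qed

lemma lie_generated_drift_plane:
  assumes C: "\<i> *\<^sub>C C \<in> su" and w: "w \<noteq> 0"
    and v: "v \<in> {a, b, c}" "v $ 1 \<noteq> 0 \<or> v $ 2 \<noteq> 0"
    and plane: "a $ 3 = 0" "b $ 3 = 0" "c $ 3 = 0"
  shows "lie_generated (tensor_su2 (mat 1) \<union> {drift w a b c C}) =
    span (generators {axis 3 1} {axis 1 1, axis 2 1})"
proof (rule lie_generated_drift[OF C])
  show "{axis 3 1} \<subseteq> W \<and> {axis 1 1, axis 2 1} \<subseteq> V"
    if cl: "cross_closed W V" and W: "w *\<^sub>R axis 3 1 \<in> W" and abc: "{a, b, c} \<subseteq> V" for W V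
  proof -
    have "v \<in> V" using abc v by blast
    then show ?thesis
      using cross_closed_plane[OF cl cross_closed_axis3[OF cl W w] _ v(2)]
        cross_closed_axis3[OF cl W w] by auto
  qed
qed (use plane in \<open>auto simp: span_axis12 span_axis3 cross_basis axis_nth\<close>)

lemma lie_generated_drift_axis:
  assumes C: "\<i> *\<^sub>C C \<in> su" and w: "w \<noteq> 0"
    and v: "v \<in> {a, b, c}" "v $ 3 \<noteq> 0"
    and ax: "\<And>v. v \<in> {a, b, c} \<Longrightarrow> v $ 1 = 0 \<and> v $ 2 = 0"
  shows "lie_generated (tensor_su2 (mat 1) \<union> {drift w a b c C}) =
    span (generators {axis 3 1} {axis 3 1})"
proof (rule lie_generated_drift[OF C])
  show "{axis 3 1} \<subseteq> W \<and> {axis 3 1} \<subseteq> V"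
    if cl: "cross_closed W V" and W: "w *\<^sub>R axis 3 1 \<in> W" and abc: "{a, b, c} \<subseteq> V" for W V
  proof -
    have "v \<in> V" using abc v by blast
    then have "(1 / v $ 3) *\<^sub>R v \<in> V"
      using cl by (simp add: cross_closed_def subspace_scale)
    also have "(1 / v $ 3) *\<^sub>R v = axis 3 1"
      using v(2) ax[OF v(1)] by (simp add: vec_eq_iff forall_3 axis_nth)
    finally show ?thesis
      using cross_closed_axis3[OF cl W w] by auto
  qed
qed (use ax in \<open>auto simp: span_axis3 axis_nth span_zero\<close>)

text \<open>Parallel vectors have zero cross product, so no operator on the first qubit alone arises
  and \<open>W\<close> may be empty, with span zero.\<close>

lemma lie_generated_drift_line:
  assumes C: "\<i> *\<^sub>C C \<in> su" and v: "v \<in> {a, b, c}" "{a, b, c} \<subseteq> span {v}"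
  shows "lie_generated (tensor_su2 (mat 1) \<union> {drift 0 a b c C}) = span (generators {} {v})"
  by (rule lie_generated_drift[OF C]) (use v in auto)

lemma lie_generated_drift_hyperplane:
  assumes C: "\<i> *\<^sub>C C \<in> su" and n: "span {a, b, c} = {x. n \<bullet> x = 0}" "norm n = 1"
    and nonzero: "\<not> (a = 0 \<and> b = 0 \<and> c = 0)"
  shows "lie_generated (tensor_su2 (mat 1) \<union> {drift 0 a b c C}) =
    span (generators {n} {x. n \<bullet> x = 0})"
proof -
  define V where "V = {x. n \<bullet> x = 0}"
  have span_V: "span V = V"
    by (simp add: V_def subspace_hyperplane)
  have V: "{a, b, c} \<subseteq> V"
    using span_superset[of "{a, b, c}"] unfolding V_def n(1) .
  obtain p where p: "p \<in> V" "p \<noteq> 0"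
    using V nonzero by auto
  have "lie_generated (tensor_su2 (mat 1) \<union> {drift 0 a b c C}) = span (generators {n} V)"
  proof (rule lie_generated_drift[OF C])
    show "{n} \<subseteq> W \<and> V \<subseteq> V'"
      if cl: "cross_closed W V'" and abc: "{a, b, c} \<subseteq> V'" for W V'
    proof -
      have VV': "V \<subseteq> V'" using cross_closed_span[OF cl abc] n(1) by (simp add: V_def)
      \<comment> \<open>For \<open>p\<close> in the plane, \<open>cross3 n p\<close> is in it too,
        and \<open>cross3 p (cross3 n p)\<close> is a positive multiple of the normal, which forces
        \<open>n\<close> into \<open>W\<close>.\<close>
      have "cross3 n p \<in> V" by (simp add: V_def dot_cross_self)
      then have "cross3 p (cross3 n p) \<in> W"
        using cl p VV' unfolding cross_closed_def by blast
      then have "(p \<bullet> p) *\<^sub>R n \<in> W"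
        using p by (simp add: Lagrange V_def inner_commute)
      then have "n \<in> W"
        using subspace_scale[of W "(p \<bullet> p) *\<^sub>R n" "1 / (p \<bullet> p)"] p cl by (simp add: cross_closed_def)
      then show ?thesis using VV' by blast
    qed
    show "cross3 u v \<in> span {n}" if "u \<in> V" "v \<in> V" for u v
    proof -
      have "cross3 u v = (n \<bullet> cross3 u v) *\<^sub>R n"
        using that n by (intro cross_orthogonal_eq_scale) (auto simp: V_def)
      then show ?thesis by (metis insertI1 span_base span_scale)
    qed
    show "a \<in> span V" "b \<in> span V" "c \<in> span V"
      using V by (auto simp: span_base)
    show "cross3 u v \<in> span V" if "u \<in> {n}" for u v
      using that unfolding span_V by (simp add: V_def dot_cross_self)
  qed (auto simp: span_zero)
  then show ?thesis by (simp add: V_def)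
qed

section \<open>Turning an arbitrary plane and its normal into the coordinate ones\<close>

lemma lie_conjugate_hyperplane:
  assumes n: "norm n = 1" and "lie_subalgebra (span (generators {n} {x. n \<bullet> x = 0}))"
  shows "lie_conjugate (span (generators {n} {x. n \<bullet> x = 0}))
    (span (generators {axis 3 1} {axis 1 1, axis 2 1}))"
proof -
  \<comment> \<open>The vectors \<open>n\<close> and \<open>- n\<close> have the same line and the
    same orthogonal plane; the sign is chosen to meet the hypothesis of
    \<open>exists_half_turn\<close>.\<close>
  define s :: real where "s = (if n \<bullet> axis 3 1 \<ge> 0 then 1 else -1)"
  have s: "s = 1 \<or> s = -1" "(s *\<^sub>R n) \<bullet> axis 3 1 \<ge> 0" "norm (s *\<^sub>R n) = 1"
    using n by (auto simp: s_def)
  obtain m where m: "norm m = 1" "half_turn m (axis 3 1) = s *\<^sub>R n"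
    using exists_half_turn[OF s(3) _ s(2)] by (auto simp: norm_axis_1)
  have img: "half_turn m ` {x. x $ 3 = 0} = {x. n \<bullet> x = 0}"
  proof -
    \<comment> \<open>A half turn is self-adjoint, so the third coordinate after turning is the
      inner product with the turned third axis.\<close>
    have dot: "half_turn m x $ 3 = s * (n \<bullet> x)" for x
      using inner_half_turn[of m x "axis 3 1"] m(2) by (simp add: inner_axis inner_commute)
    show ?thesis
    proof (intro equalityI subsetI)
      fix y assume "y \<in> half_turn m ` {x. x $ 3 = 0}"
      then obtain x where "y = half_turn m x" "x $ 3 = 0" by blast
      then have "s * (n \<bullet> y) = 0"
        using dot[of y] half_turn_half_turn[OF m(1), of x] by simp
      then show "y \<in> {x. n \<bullet> x = 0}"
        using s(1) by auto
    next
      fix y assume "y \<in> {x. n \<bullet> x = 0}"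
      then have "half_turn m y $ 3 = 0"
        by (simp add: dot)
      then show "y \<in> half_turn m ` {x. x $ 3 = 0}"
        using half_turn_half_turn[OF m(1), of y] by (intro image_eqI[of _ _ "half_turn m y"]) auto
    qed
  qed
  have scale: "span {s *\<^sub>R n} = span {n}"
    using s(1) span_image_scale[of "{n}" "\<lambda>_. s"] by auto
  have "span (generators {n} {x. n \<bullet> x = 0}) = span (generators {s *\<^sub>R n} {x. n \<bullet> x = 0})"
    by (intro span_generators_cong) (simp_all add: scale)
  also have "\<dots> = span (generators (half_turn m ` {axis 3 1}) (half_turn m ` {x. x $ 3 = 0}))"
    using m(2) img by simp
  also have "\<dots> = (\<lambda>X. half_turn_matrix m ** X ** ctranspose (half_turn_matrix m)) `
      span (generators {axis 3 1} {x. x $ 3 = 0})"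
    using conjugate_span_generators[OF m(1)] by simp
  also have "span (generators {axis 3 1} {x. x $ 3 = 0}) =
      span (generators {axis 3 1} {axis 1 1, axis 2 1})"
    by (intro span_generators_cong) (simp_all flip: span_axis12)
  finally have conj: "span (generators {n} {x. n \<bullet> x = 0}) =
    (\<lambda>X. half_turn_matrix m ** X ** ctranspose (half_turn_matrix m)) `
      span (generators {axis 3 1} {axis 1 1, axis 2 1})" .
  have "lie_subalgebra (span (generators {axis 3 1} {axis 1 1, axis 2 1}))"
    by (rule lie_subalgebra_span_generators)
      (auto simp: span_axis12 span_axis3 cross_basis axis_nth)
  then show ?thesis
    unfolding lie_conjugate_def
    using assms(2) span_generators_subset_su unitary_half_turn_matrix[OF m(1)] conj by blast
qed

section \<open>The cases in terms of \<open>D\<close>, \<open>F\<close> and the rank of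
  \<open>K\<close>\<close>

theorem theorem2:
  fixes \<omega>\<^sub>S :: real
    and a b c :: "real^3"
    and C :: "complex^2^2"
    and \<B> \<L> :: "(complex^(2 \<times> 2)^(2 \<times> 2)) set"
    and K :: "real^3^3"
    and D :: "real^2^3"
    and F :: "real^1^3"
  assumes "\<not> (a = 0 \<and> b = 0 \<and> c = 0)"
    and "hermitian C"
    and "\<i> *\<^sub>C C \<in> su"
    and "\<B> = tensor_su2 (mat 1)"
    and "\<L> = lie_generated (\<B> \<union> {drift \<omega>\<^sub>S a b c C})"
    and "K = vector [a, b, c]"
    and "D = (\<chi> i. vector [K $ i $ 1, K $ i $ 2])"
    and "F = (\<chi> i. vector [K $ i $ 3])"
  shows "(\<omega>\<^sub>S \<noteq> 0 \<and> D \<noteq> 0 \<and> F \<noteq> 0 \<longrightarrow>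
      \<L> = su) \<and>
    (\<omega>\<^sub>S \<noteq> 0 \<and> D \<noteq> 0 \<and> F = 0 \<longrightarrow>
      \<L> = span ({sigma_z \<otimes>\<^sub>K mat 1} \<union> tensor_su2 (mat 1) \<union>
                tensor_su2 (\<i> *\<^sub>C sigma_x) \<union> tensor_su2 (\<i> *\<^sub>C sigma_y)) \<and>
      dim \<L> = 10) \<and>
    (\<omega>\<^sub>S \<noteq> 0 \<and> D = 0 \<and> F \<noteq> 0 \<longrightarrow>
      \<L> = span (tensor_su2 (\<i> *\<^sub>C sigma_z) \<union> {sigma_z \<otimes>\<^sub>K mat 1} \<union> tensor_su2 (mat 1)) \<and>
      dim \<L> = 7) \<and>
    (\<omega>\<^sub>S = 0 \<and> rank K = 1 \<longrightarrow>
      (\<exists>\<sigma>\<in>su. \<L> = span (tensor_su2 (\<i> *\<^sub>C \<sigma>) \<union> tensor_su2 (mat 1)))) \<and>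
    (\<omega>\<^sub>S = 0 \<and> rank K = 2 \<longrightarrow>
      (let \<M> = span ({sigma_z \<otimes>\<^sub>K mat 1} \<union> tensor_su2 (mat 1) \<union>
                    tensor_su2 (\<i> *\<^sub>C sigma_x) \<union> tensor_su2 (\<i> *\<^sub>C sigma_y))
       in lie_conjugate \<L> \<M> \<and> lie_isomorphic \<L> \<M>)) \<and>
    (\<omega>\<^sub>S = 0 \<and> rank K = 3 \<longrightarrow>
      \<L> = su)"
proof -
  have C: "\<i> *\<^sub>C C \<in> su" by fact
  have L: "\<L> = lie_generated (tensor_su2 (mat 1) \<union> {drift \<omega>\<^sub>S a b c C})"
    using assms by simp
  have K: "K $ 1 = a" "K $ 2 = b" "K $ 3 = c"
    by (simp_all add: assms(6))
  have D0: "D = 0 \<longleftrightarrow> (\<forall>v\<in>{a, b, c}. v $ 1 = 0 \<and> v $ 2 = 0)"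
    by (simp add: assms(7) vec_eq_iff forall_2 forall_3 K) blast
  have F0: "F = 0 \<longleftrightarrow> (\<forall>v\<in>{a, b, c}. v $ 3 = 0)"
    by (simp add: assms(8) vec_eq_iff forall_1 forall_3 K vector_def) blast
  have "rows K = ($) K ` UNIV"
    by (auto simp: rows_def row_def)
  then have "rows K = {a, b, c}"
    by (simp add: UNIV_3 K)
  then have rank: "rank K = dim {a, b, c}"
    by (simp add: row_rank_def)
  have gen: "generators {axis 3 1} {axis 1 1, axis 2 1} =
      {sigma_z \<otimes>\<^sub>K mat 1} \<union> tensor_su2 (mat 1) \<union>
      tensor_su2 (\<i> *\<^sub>C sigma_x) \<union> tensor_su2 (\<i> *\<^sub>C sigma_y)"
    "generators {axis 3 1} {axis 3 1} =
      tensor_su2 (\<i> *\<^sub>C sigma_z) \<union> {sigma_z \<otimes>\<^sub>K mat 1} \<union> tensor_su2 (mat 1)"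
    "generators {} {v} = tensor_su2 (\<i> *\<^sub>C sigma_vec v) \<union> tensor_su2 (mat 1)" for v
    by (auto simp: generators_def tensor_su2_mat_1 sigma_left_def sigma_vec_axis
        simp flip: tensor_su2_sigma_vec)
  have "\<L> = su" if "\<omega>\<^sub>S \<noteq> 0" "D \<noteq> 0" "F \<noteq> 0"
    using that D0 F0 lie_generated_drift_full[OF C] unfolding L by meson
  moreover have "\<L> = span (generators {axis 3 1} {axis 1 1, axis 2 1}) \<and> dim \<L> = 10"
    if "\<omega>\<^sub>S \<noteq> 0" "D \<noteq> 0" "F = 0"
  proof -
    have "\<L> = span (generators {axis 3 1} {axis 1 1, axis 2 1})"
      using that D0 F0 lie_generated_drift_plane[OF C] unfolding L by (meson insertI1 insertI2)
    \<comment> \<open>The dimension is 1 + 3 + 3 * 2, from a line \<open>W\<close> and a plane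
      \<open>V\<close>.\<close>
    then show ?thesis
      by (simp only: dim_span_generators dim_span_axis12 dim_span_axis3) simp
  qed
  moreover have "\<L> = span (generators {axis 3 1} {axis 3 1}) \<and> dim \<L> = 7"
    if "\<omega>\<^sub>S \<noteq> 0" "D = 0" "F \<noteq> 0"
  proof -
    have "\<L> = span (generators {axis 3 1} {axis 3 1})"
      using that D0 F0 lie_generated_drift_axis[OF C] unfolding L by meson
    then show ?thesis
      by (simp only: dim_span_generators dim_span_axis3) simp
  qed
  moreover have "\<exists>\<sigma>\<in>su. \<L> = span (tensor_su2 (\<i> *\<^sub>C \<sigma>) \<union> tensor_su2 (mat 1))"
    if "\<omega>\<^sub>S = 0" "rank K = 1"
  proof -
    \<comment> \<open>The basis is taken among the rows themselves, so that its single element is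
      one of \<open>a\<close>, \<open>b\<close>, \<open>c\<close> and hence forced into
      \<open>V\<close>.\<close>
    obtain B where B: "B \<subseteq> {a, b, c}" "{a, b, c} \<subseteq> span B" "card B = 1"
      using basis_exists[of "{a, b, c}"] \<open>rank K = 1\<close> rank by metis
    then obtain v where "B = {v}" by (meson card_1_singletonE)
    with B lie_generated_drift_line[OF C] have "\<L> = span (generators {} {v})"
      unfolding L \<open>\<omega>\<^sub>S = 0\<close> by auto
    moreover have "sigma_vec v \<in> su" by (simp add: su2_eq_range_sigma_vec)
    ultimately show ?thesis using gen(3) by metis
  qed
  moreover have "lie_conjugate \<L> (span (generators {axis 3 1} {axis 1 1, axis 2 1}))"
    if "\<omega>\<^sub>S = 0" "rank K = 2"
  proof -
    obtain n where n: "n \<noteq> 0" "span {a, b, c} = {x. n \<bullet> x = 0}"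
      using lowdim_eq_hyperplane[of "{a, b, c}"] \<open>rank K = 2\<close> rank by auto
    define n' where "n' = (1 / norm n) *\<^sub>R n"
    have n': "norm n' = 1" "span {a, b, c} = {x. n' \<bullet> x = 0}"
      using n by (auto simp: n'_def)
    have "\<L> = span (generators {n'} {x. n' \<bullet> x = 0})"
      unfolding L \<open>\<omega>\<^sub>S = 0\<close> by (rule lie_generated_drift_hyperplane[OF C n'(2,1) assms(1)])
    \<comment> \<open>The span is a Lie subalgebra because it equals the generated algebra
      \<open>\<L>\<close>.\<close>
    then show ?thesis
      using lie_conjugate_hyperplane[OF n'(1)] lie_subalgebra_lie_generated L by metis
  qed
  moreover have "\<L> = su" if "\<omega>\<^sub>S = 0" "rank K = 3"
    unfolding L
  proof (rule lie_generated_drift_su4[OF C])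
    have "span {a, b, c} = UNIV"
      using \<open>rank K = 3\<close> rank dim_eq_full[of "{a, b, c}"] by simp
    then show "V = UNIV" if "cross_closed W V" "{a, b, c} \<subseteq> V" for W V
      using cross_closed_span[OF that] by auto
  qed
  ultimately show ?thesis
    unfolding Let_def gen by (blast intro: lie_conjugate_imp_isomorphic)
qed

end
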